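(* Let $X$ be a Banach space and let $\mathcal{U}=\{U(t,s)\}_{t\ge s\ge 0}$ be a nonuniform exponentially bounded evolution family on $X$. Each $\alpha\in\mathcal{A}(\mathcal{U})$ defines a $C_0$-semigroup $\mathcal{T}_\alpha=\{T_\alpha(t)\}_{t\ge 0}$ on $\mathcal{C}(\mathcal{U},\alpha)$ by setting, for $u\in\mathcal{C}(\mathcal{U},\alpha)$ and $t\ge 0$, $$(T_\alpha(t)u)(s)=\begin{cases}U(s,s-t)u(s-t), & \text{if } s>t,\\ 0, & \text{if } 0\le s\le t.\end{cases}$$ Moreover, the following estimate holds: $$\|T_\alpha(t)u\|_{\mathcal{U},\alpha}\le e^{\alpha t}\|u\|_{\mathcal{U},\alpha},\qquad u\in\mathcal{C}(\mathcal{U},\alpha),\ t\ge 0.$$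
   Context: $\mathbb{R}_+=[0,\infty)$, and $C(\mathbb{R}_+,X)$ is the space of all continuous functions $\mathbb{R}_+\to X$. An evolution family (on the half-line) is a family $\mathcal{U}=\{U(t,s)\}_{t\ge s\ge 0}$ of bounded linear operators on $X$ such that $U(t,t)=\mathrm{Id}$ for $t\ge 0$; $U(t,\tau)U(\tau,s)=U(t,s)$ for $t\ge\tau\ge s\ge 0$; and $(t,s)\mapsto U(t,s)x$ is continuous on $\{t\ge s\ge 0\}$ for every $x\in X$. A number $\alpha\in\mathbb{R}$ is an admissible exponent of $\mathcal{U}$ if there is a continuous map $M_\alpha:\mathbb{R}_+\to(0,\infty)$ with $\|U(t,s)\|\le M_\alpha(s)e^{\alpha(t-s)}$ for all $t\ge s\ge 0$. $\mathcal{A}(\mathcal{U})$ is the set of all admissible exponents, and $\mathcal{U}$ is nonuniform exponentially bounded if $\mathcal{A}(\mathcal{U})\ne\emptyset$. For $\alpha\in\mathcal{A}(\mathcal{U})$, $t\ge 0$ and $u\in C(\mathbb{R}_+,X)$, put $\varphi_{\mathcal{U},\alpha}(t,u)=\sup_{\tau\ge t}e^{-\alpha(\tau-t)}\|U(\tau,t)u(t)\|$. The admissible Banach function space is $$\mathcal{C}(\mathcal{U},\alpha)=\{u\in C(\mathbb{R}_+,X):\ \lim_{t\to\infty}\varphi_{\mathcal{U},\alpha}(t,u)=\|u(0)\|=0\},$$ which is a Banach space with the norm $\|u\|_{\mathcal{U},\alpha}=\sup_{t\ge 0}\varphi_{\mathcal{U},\alpha}(t,u)$. A $C_0$-semigroup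 on a Banach space $E$ is a family $\{T(t)\}_{t\ge 0}$ of bounded linear operators on $E$ with $T(0)=\mathrm{Id}$, $T(t)T(s)=T(t+s)$ for $t,s\ge 0$, and $\lim_{t\to 0_+}T(t)x=x$ for every $x\in E$. *)

theory Defs
  imports "HOL-Analysis.Analysis" "HOL-Library.Function_Algebras"
begin

section \<open>Normed subspaces and \<open>C\<^sub>0\<close>-semigroups on them\<close>

text \<open>The function space below depends on the parameters \<open>U\<close> and \<open>\<alpha>\<close>, so it is a carrier set
  with its own norm inside the vector space of all functions, which is given the pointwise
  structure.\<close>

instantiation "fun" :: (type, real_vector) real_vector
begin

definition scaleR_fun :: "real \<Rightarrow> ('a \<Rightarrow> 'b) \<Rightarrow> 'a \<Rightarrow> 'b"
  where "scaleR_fun c f = (\<lambda>x. c *\<^sub>R f x)"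

instance
  by standard (auto simp: scaleR_fun_def fun_eq_iff scaleR_add_right scaleR_add_left)

end

definition norm_on :: "'e::real_vector set \<Rightarrow> ('e \<Rightarrow> real) \<Rightarrow> bool" where
  "norm_on E N \<longleftrightarrow>
     (\<forall>x\<in>E. 0 \<le> N x \<and> (N x = 0 \<longleftrightarrow> x = 0)) \<and>
     (\<forall>x\<in>E. \<forall>y\<in>E. N (x + y) \<le> N x + N y) \<and>
     (\<forall>c. \<forall>x\<in>E. N (c *\<^sub>R x) = \<bar>c\<bar> * N x)"

definition banach_space_on :: "'e::real_vector set \<Rightarrow> ('e \<Rightarrow> real) \<Rightarrow> bool" where
  "banach_space_on E N \<longleftrightarrow> subspace E \<and> norm_on E N \<and>
     (\<forall>X. (\<forall>n::nat. X n \<in> E) \<and> (\<forall>e>0. \<exists>n0. \<forall>m\<ge>n0. \<forall>n\<ge>n0. N (X m - X n) < e)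
        \<longrightarrow> (\<exists>x\<in>E. (\<lambda>n. N (X n - x)) \<longlonglongrightarrow> 0))"

definition bounded_operator_on ::
    "'e::real_vector set \<Rightarrow> ('e \<Rightarrow> real) \<Rightarrow> ('e \<Rightarrow> 'e) \<Rightarrow> bool" where
  "bounded_operator_on E N A \<longleftrightarrow>
     (\<forall>x\<in>E. A x \<in> E) \<and>
     (\<forall>x\<in>E. \<forall>y\<in>E. A (x + y) = A x + A y) \<and>
     (\<forall>c. \<forall>x\<in>E. A (c *\<^sub>R x) = c *\<^sub>R A x) \<and>
     (\<exists>K. \<forall>x\<in>E. N (A x) \<le> K * N x)"

definition C0_semigroup_on ::
    "'e::real_vector set \<Rightarrow> ('e \<Rightarrow> real) \<Rightarrow> (real \<Rightarrow> 'e \<Rightarrow> 'e) \<Rightarrow> bool" where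
  "C0_semigroup_on E N T \<longleftrightarrow> banach_space_on E N \<and>
     (\<forall>t\<ge>0. bounded_operator_on E N (T t)) \<and>
     (\<forall>x\<in>E. T 0 x = x) \<and>
     (\<forall>t\<ge>0. \<forall>s\<ge>0. \<forall>x\<in>E. T t (T s x) = T (t + s) x) \<and>
     (\<forall>x\<in>E. ((\<lambda>t. N (T t x - x)) \<longlongrightarrow> 0) (at_right 0))"


section \<open>Evolution families on the half-line\<close>

text \<open>Only the operators \<open>U t s\<close> with \<open>t \<ge> s \<ge> 0\<close> are part of the family; the other values of
  the total function \<open>U\<close> are irrelevant.\<close>

definition evolution_family :: "(real \<Rightarrow> real \<Rightarrow> 'a::real_normed_vector \<Rightarrow>\<^sub>L 'a) \<Rightarrow> bool" where
  "evolution_family U \<longleftrightarrow>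
     (\<forall>t\<ge>0. U t t = id_blinfun) \<and>
     (\<forall>t \<tau> s. t \<ge> \<tau> \<and> \<tau> \<ge> s \<and> s \<ge> 0 \<longrightarrow> U t \<tau> o\<^sub>L U \<tau> s = U t s) \<and>
     (\<forall>x. continuous_on {(t, s). t \<ge> s \<and> s \<ge> 0} (\<lambda>(t, s). blinfun_apply (U t s) x))"

definition admissible_exponents ::
    "(real \<Rightarrow> real \<Rightarrow> 'a::real_normed_vector \<Rightarrow>\<^sub>L 'a) \<Rightarrow> real set" where
  "admissible_exponents U =
     {\<alpha>. \<exists>M :: real \<Rightarrow> real. continuous_on {0..} M \<and> (\<forall>s\<ge>0. M s > 0) \<and>
          (\<forall>t s. t \<ge> s \<and> s \<ge> 0 \<longrightarrow> norm (U t s) \<le> M s * exp (\<alpha> * (t - s)))}"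

definition nonuniform_exp_bounded ::
    "(real \<Rightarrow> real \<Rightarrow> 'a::real_normed_vector \<Rightarrow>\<^sub>L 'a) \<Rightarrow> bool" where
  "nonuniform_exp_bounded U \<longleftrightarrow> admissible_exponents U \<noteq> {}"


section \<open>The admissible Banach function space\<close>

text \<open>A function on \<open>[0, \<infinity>)\<close> is represented by its extension by \<open>0\<close> to the real line, so that
  equality of representatives is equality on \<open>[0, \<infinity>)\<close>.\<close>

definition half_line_continuous :: "(real \<Rightarrow> 'a::real_normed_vector) set" where
  "half_line_continuous = {u. continuous_on {0..} u \<and> (\<forall>s<0. u s = 0)}"

text \<open>For \<open>\<alpha> \<in> admissible_exponents U\<close> and \<open>t \<ge> 0\<close> the supremum in \<open>adm_phi\<close> is over a set
  bounded by \<open>M t * norm (u t)\<close>; the one in \<open>adm_norm\<close> is over a bounded set whenever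
  \<open>u \<in> adm_space U \<alpha>\<close>.\<close>

definition adm_phi ::
    "(real \<Rightarrow> real \<Rightarrow> 'a::real_normed_vector \<Rightarrow>\<^sub>L 'a) \<Rightarrow> real \<Rightarrow> real \<Rightarrow> (real \<Rightarrow> 'a) \<Rightarrow> real" where
  "adm_phi U \<alpha> t u =
     (SUP \<tau>\<in>{t..}. exp (- \<alpha> * (\<tau> - t)) * norm (blinfun_apply (U \<tau> t) (u t)))"

definition adm_space ::
    "(real \<Rightarrow> real \<Rightarrow> 'a::real_normed_vector \<Rightarrow>\<^sub>L 'a) \<Rightarrow> real \<Rightarrow> (real \<Rightarrow> 'a) set" where
  "adm_space U \<alpha> =
     {u \<in> half_line_continuous. ((\<lambda>t. adm_phi U \<alpha> t u) \<longlongrightarrow> 0) at_top \<and> norm (u 0) = 0}"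

definition adm_norm ::
    "(real \<Rightarrow> real \<Rightarrow> 'a::real_normed_vector \<Rightarrow>\<^sub>L 'a) \<Rightarrow> real \<Rightarrow> (real \<Rightarrow> 'a) \<Rightarrow> real" where
  "adm_norm U \<alpha> u = (SUP t\<in>{0..}. adm_phi U \<alpha> t u)"

text \<open>The formula does not involve \<open>\<alpha>\<close>; \<open>\<alpha>\<close> only determines the space it acts on.
  For \<open>t \<ge> 0\<close> the values at \<open>s < 0\<close> are \<open>0\<close>, as required of representatives.\<close>

definition evolution_semigroup ::
    "(real \<Rightarrow> real \<Rightarrow> 'a::real_normed_vector \<Rightarrow>\<^sub>L 'a) \<Rightarrow> real \<Rightarrow> (real \<Rightarrow> 'a) \<Rightarrow> real \<Rightarrow> 'a" where
  "evolution_semigroup U t u =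
     (\<lambda>s. if s > t then blinfun_apply (U s (s - t)) (u (s - t)) else 0)"

end

theory Submission
  imports Defs
begin

text \<open>For fixed \<open>\<alpha>\<close> every time \<open>t \<ge> 0\<close> carries the norm
  \<open>p\<^sub>t x = sup {exp (-\<alpha> (\<tau> - t)) \<parallel>U \<tau> t x\<parallel> | \<tau> \<ge> t}\<close>, and \<open>\<C>(U, \<alpha>)\<close> is the space of
  continuous \<open>u\<close> with \<open>u 0 = 0\<close> and \<open>p\<^sub>t (u t) \<rightarrow> 0\<close>, under the norm \<open>sup\<^sub>t p\<^sub>t (u t)\<close>.
  Two facts about \<open>p\<^sub>t\<close> drive everything.

  \<^item> It renorms \<open>X\<close>, with a constant that is locally bounded in \<open>t\<close>:
    \<open>\<parallel>x\<parallel> \<le> p\<^sub>t x \<le> M t \<parallel>x\<parallel>\<close>. The left inequality turns Cauchy sequences of the space into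
    uniformly Cauchy sequences of functions, which gives completeness. The right one makes
    uniform convergence on a compact interval convergence in the weighted norm there.
  \<^item> The family is exponentially bounded for these norms, with constant one:
    \<open>p\<^sub>s (U s r x) \<le> exp (\<alpha> (s - r)) p\<^sub>r x\<close>, because the orbit of \<open>U s r x\<close> is a tail of the
    orbit of \<open>x\<close>. The invariance of the space and the growth estimate are this inequality
    read pointwise, with \<open>r = s - t\<close>.

  For strong continuity, the decay of \<open>p\<^sub>t (u t)\<close> makes both \<open>T t u\<close> and \<open>u\<close> small beyond some
  time \<open>L\<close>, uniformly for \<open>t \<in> [0, 1]\<close>. On \<open>[0, L]\<close> it remains to see that
  \<open>(T t u) s \<rightarrow> u s\<close> uniformly in \<open>s\<close>. Since \<open>u 0 = 0\<close>, the two branches in the definition of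
  \<open>T t u\<close> fit together, and \<open>(t, s) \<mapsto> (T t u) s\<close> is continuous, hence uniformly continuous on
  \<open>[0, 1] \<times> [0, L]\<close>.\<close>

section \<open>The weighted norms at a fixed time\<close>

definition orbit_norm ::
    "(real \<Rightarrow> real \<Rightarrow> 'a::real_normed_vector \<Rightarrow>\<^sub>L 'a) \<Rightarrow> real \<Rightarrow> real \<Rightarrow> 'a \<Rightarrow> real" where
  "orbit_norm U \<alpha> t x = (SUP \<tau>\<in>{t..}. exp (- \<alpha> * (\<tau> - t)) * norm (blinfun_apply (U \<tau> t) x))"

lemma adm_phi_eq_orbit_norm: "adm_phi U \<alpha> t u = orbit_norm U \<alpha> t (u t)"
  by (simp add: adm_phi_def orbit_norm_def)

locale exp_bounded_family =
  fixes U :: "real \<Rightarrow> real \<Rightarrow> 'a::banach \<Rightarrow>\<^sub>L 'a" and \<alpha> :: real and M :: "real \<Rightarrow> real"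
  assumes evolution: "evolution_family U"
    and M_continuous: "continuous_on {0..} M"
    and norm_U_le: "\<And>t s. t \<ge> s \<Longrightarrow> s \<ge> 0 \<Longrightarrow> norm (U t s) \<le> M s * exp (\<alpha> * (t - s))"
begin

abbreviation p :: "real \<Rightarrow> 'a \<Rightarrow> real" where
  "p \<equiv> orbit_norm U \<alpha>"

lemma U_refl: "t \<ge> 0 \<Longrightarrow> blinfun_apply (U t t) x = x"
  using evolution by (simp add: evolution_family_def)

lemma U_comp:
  assumes "t \<ge> \<tau>" "\<tau> \<ge> s" "s \<ge> 0"
  shows "blinfun_apply (U t \<tau>) (blinfun_apply (U \<tau> s) x) = blinfun_apply (U t s) x"
proof -
  have "U t \<tau> o\<^sub>L U \<tau> s = U t s"
    using evolution assms by (simp add: evolution_family_def)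
  then show ?thesis
    by (metis blinfun_apply_blinfun_compose)
qed

lemma orbit_le:
  assumes "\<tau> \<ge> t" "t \<ge> 0"
  shows "exp (- \<alpha> * (\<tau> - t)) * norm (blinfun_apply (U \<tau> t) x) \<le> M t * norm x"
proof -
  have "norm (blinfun_apply (U \<tau> t) x) \<le> norm (U \<tau> t) * norm x"
    by (rule norm_blinfun)
  also have "\<dots> \<le> (M t * exp (\<alpha> * (\<tau> - t))) * norm x"
    by (intro mult_right_mono norm_U_le assms) auto
  finally have "exp (- \<alpha> * (\<tau> - t)) * norm (blinfun_apply (U \<tau> t) x)
      \<le> exp (- \<alpha> * (\<tau> - t)) * (M t * exp (\<alpha> * (\<tau> - t)) * norm x)"
    by (intro mult_left_mono) auto
  also have "\<dots> = (exp (- \<alpha> * (\<tau> - t)) * exp (\<alpha> * (\<tau> - t))) * (M t * norm x)"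
    by (simp add: algebra_simps)
  also have "\<dots> = M t * norm x"
    by (simp flip: exp_add)
  finally show ?thesis .
qed

lemma orbit_le_orbit_norm:
  assumes "\<tau> \<ge> t" "t \<ge> 0"
  shows "exp (- \<alpha> * (\<tau> - t)) * norm (blinfun_apply (U \<tau> t) x) \<le> p t x"
  unfolding orbit_norm_def
  using assms by (intro cSUP_upper bdd_aboveI2[where M = "M t * norm x"] orbit_le) auto

lemma orbit_norm_leI:
  assumes "\<And>\<tau>. \<tau> \<ge> t \<Longrightarrow> exp (- \<alpha> * (\<tau> - t)) * norm (blinfun_apply (U \<tau> t) x) \<le> c"
  shows "p t x \<le> c"
  unfolding orbit_norm_def using assms by (intro cSUP_least) auto

lemma orbit_norm_le: "t \<ge> 0 \<Longrightarrow> p t x \<le> M t * norm x"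
  by (intro orbit_norm_leI orbit_le)

lemma norm_le_orbit_norm: "t \<ge> 0 \<Longrightarrow> norm x \<le> p t x"
  using orbit_le_orbit_norm[of t t x] by (simp add: U_refl)

lemma orbit_norm_nonneg: "t \<ge> 0 \<Longrightarrow> 0 \<le> p t x"
  using norm_le_orbit_norm[of t x] norm_ge_zero[of x] by linarith

lemma orbit_norm_zero: "t \<ge> 0 \<Longrightarrow> p t 0 = 0"
  using orbit_norm_le[of t 0] orbit_norm_nonneg[of t 0] by simp

lemma orbit_norm_triangle:
  assumes "t \<ge> 0"
  shows "p t (x + y) \<le> p t x + p t y"
proof (rule orbit_norm_leI)
  fix \<tau> assume "\<tau> \<ge> t"
  have "exp (- \<alpha> * (\<tau> - t)) * norm (blinfun_apply (U \<tau> t) (x + y))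
     \<le> exp (- \<alpha> * (\<tau> - t)) * (norm (blinfun_apply (U \<tau> t) x) + norm (blinfun_apply (U \<tau> t) y))"
    by (intro mult_left_mono) (auto simp: blinfun.add_right norm_triangle_ineq)
  also have "\<dots> \<le> p t x + p t y"
    using orbit_le_orbit_norm[OF \<open>\<tau> \<ge> t\<close> assms, of x] orbit_le_orbit_norm[OF \<open>\<tau> \<ge> t\<close> assms, of y]
    by (simp add: distrib_left)
  finally show "exp (- \<alpha> * (\<tau> - t)) * norm (blinfun_apply (U \<tau> t) (x + y)) \<le> p t x + p t y" .
qed

lemma orbit_norm_scaleR_le:
  assumes "t \<ge> 0"
  shows "p t (c *\<^sub>R x) \<le> \<bar>c\<bar> * p t x"
proof (rule orbit_norm_leI)
  fix \<tau> assume "\<tau> \<ge> t"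
  have "exp (- \<alpha> * (\<tau> - t)) * norm (blinfun_apply (U \<tau> t) (c *\<^sub>R x))
      = \<bar>c\<bar> * (exp (- \<alpha> * (\<tau> - t)) * norm (blinfun_apply (U \<tau> t) x))"
    by (simp add: blinfun.scaleR_right)
  also have "\<dots> \<le> \<bar>c\<bar> * p t x"
    by (intro mult_left_mono orbit_le_orbit_norm \<open>\<tau> \<ge> t\<close> assms) auto
  finally show "exp (- \<alpha> * (\<tau> - t)) * norm (blinfun_apply (U \<tau> t) (c *\<^sub>R x)) \<le> \<bar>c\<bar> * p t x" .
qed

lemma orbit_norm_diff_le: "t \<ge> 0 \<Longrightarrow> p t (x - y) \<le> p t x + p t y"
  using orbit_norm_triangle[of t x "- y"] orbit_norm_scaleR_le[of t "-1" y] by simp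

text \<open>The orbit of \<open>U s r x\<close> from time \<open>s\<close> is the orbit of \<open>x\<close> from time \<open>r\<close>, cut off before \<open>s\<close>;
  only the weights differ, by the factor \<open>exp (\<alpha> (s - r))\<close>.\<close>

lemma orbit_norm_U_le:
  assumes "s \<ge> r" "r \<ge> 0"
  shows "p s (blinfun_apply (U s r) x) \<le> exp (\<alpha> * (s - r)) * p r x"
proof (rule orbit_norm_leI)
  fix \<tau> assume "\<tau> \<ge> s"
  have "exp (- \<alpha> * (\<tau> - s)) = exp (\<alpha> * (s - r)) * exp (- \<alpha> * (\<tau> - r))"
    by (simp add: algebra_simps flip: exp_add)
  then have "exp (- \<alpha> * (\<tau> - s)) * norm (blinfun_apply (U \<tau> s) (blinfun_apply (U s r) x))
      = exp (\<alpha> * (s - r)) * (exp (- \<alpha> * (\<tau> - r)) * norm (blinfun_apply (U \<tau> r) x))"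
    using U_comp[OF \<open>\<tau> \<ge> s\<close> assms] by simp
  also have "\<dots> \<le> exp (\<alpha> * (s - r)) * p r x"
    using \<open>\<tau> \<ge> s\<close> assms by (intro mult_left_mono orbit_le_orbit_norm) auto
  finally show "exp (- \<alpha> * (\<tau> - s)) * norm (blinfun_apply (U \<tau> s) (blinfun_apply (U s r) x))
      \<le> exp (\<alpha> * (s - r)) * p r x" .
qed

section \<open>The admissible space is a Banach space\<close>

lemma adm_spaceD:
  assumes "u \<in> adm_space U \<alpha>"
  shows "continuous_on {0..} u" "\<And>s. s \<le> 0 \<Longrightarrow> u s = 0"
    "((\<lambda>t. p t (u t)) \<longlongrightarrow> 0) at_top"
proof -
  show "u s = 0" if "s \<le> 0" for s
    using that assms by (cases "s = 0") (auto simp: adm_space_def half_line_continuous_def)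
qed (use assms in \<open>auto simp: adm_space_def half_line_continuous_def adm_phi_eq_orbit_norm\<close>)

lemma adm_spaceI:
  assumes "continuous_on {0..} u" "\<And>s. s \<le> 0 \<Longrightarrow> u s = 0"
    "((\<lambda>t. p t (u t)) \<longlongrightarrow> 0) at_top"
  shows "u \<in> adm_space U \<alpha>"
  using assms by (auto simp: adm_space_def half_line_continuous_def adm_phi_eq_orbit_norm)

text \<open>Since \<open>M\<close> is continuous, the weighted norms are uniformly controlled by the norm of \<open>X\<close> on
  compact time intervals.\<close>

lemma M_bounded_on_interval:
  obtains K where "K > 0" "\<And>s. 0 \<le> s \<Longrightarrow> s \<le> L \<Longrightarrow> M s \<le> K"
proof -
  have "compact (M ` {0..L})"
    by (intro compact_continuous_image continuous_on_subset[OF M_continuous]) auto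
  then obtain B where "\<And>s. s \<in> {0..L} \<Longrightarrow> norm (M s) \<le> B"
    by (metis compact_imp_bounded bounded_iff imageI)
  then have "M s \<le> max B 1" if "0 \<le> s" "s \<le> L" for s
    using that by (force simp: max_def)
  then show ?thesis
    by (intro that[of "max B 1"]) auto
qed

lemma eventually_small:
  assumes "u \<in> adm_space U \<alpha>" "e > 0"
  obtains L where "L \<ge> 0" "\<And>t. t \<ge> L \<Longrightarrow> p t (u t) < e"
proof -
  have "\<forall>\<^sub>F t in at_top. p t (u t) < e"
    using order_tendstoD(2)[OF adm_spaceD(3)[OF assms(1)] assms(2)] .
  then obtain L where "\<And>t. t \<ge> L \<Longrightarrow> p t (u t) < e"
    by (auto simp: eventually_at_top_linorder)
  then show ?thesis
    by (intro that[of "max L 0"]) auto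
qed

text \<open>The supremum defining the norm is finite: the decay at infinity bounds it on a tail, and
  \<open>M t \<parallel>u t\<parallel>\<close> bounds it on the remaining compact interval.\<close>

lemma adm_norm_bdd:
  assumes "u \<in> adm_space U \<alpha>"
  shows "bdd_above ((\<lambda>t. p t (u t)) ` {0..})"
proof -
  obtain L where L: "L \<ge> 0" "\<And>t. t \<ge> L \<Longrightarrow> p t (u t) < 1"
    using eventually_small[OF assms, of 1] by auto
  have "compact ((\<lambda>t. M t * norm (u t)) ` {0..L})"
    by (intro compact_continuous_image continuous_intros
        continuous_on_subset[OF M_continuous] continuous_on_subset[OF adm_spaceD(1)[OF assms]]) auto
  then obtain B where B: "\<And>t. t \<in> {0..L} \<Longrightarrow> norm (M t * norm (u t)) \<le> B"
    by (metis (no_types, lifting) compact_imp_bounded bounded_iff imageI)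
  show ?thesis
  proof (rule bdd_aboveI2[where M = "max B 1"])
    fix t :: real assume t: "t \<in> {0..}"
    show "p t (u t) \<le> max B 1"
    proof (cases "t \<le> L")
      case True
      then have "norm (M t * norm (u t)) \<le> B"
        using B t by auto
      then show ?thesis
        using orbit_norm_le[of t "u t"] t by (auto simp del: norm_mult)
    next
      case False
      then show ?thesis
        using L(2)[of t] by simp
    qed
  qed
qed

lemma le_adm_norm: "u \<in> adm_space U \<alpha> \<Longrightarrow> t \<ge> 0 \<Longrightarrow> p t (u t) \<le> adm_norm U \<alpha> u"
  unfolding adm_norm_def adm_phi_eq_orbit_norm by (intro cSUP_upper adm_norm_bdd) auto

lemma adm_norm_leI:
  assumes "\<And>t. t \<ge> 0 \<Longrightarrow> p t (u t) \<le> c"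
  shows "adm_norm U \<alpha> u \<le> c"
  unfolding adm_norm_def adm_phi_eq_orbit_norm using assms by (intro cSUP_least) auto

lemma adm_norm_nonneg: "u \<in> adm_space U \<alpha> \<Longrightarrow> 0 \<le> adm_norm U \<alpha> u"
  using le_adm_norm[of u 0] orbit_norm_nonneg[of 0 "u 0"] by simp

lemma tendsto_zero_orbit_normI:
  assumes "(f \<longlongrightarrow> 0) at_top" "\<And>t. t \<ge> 0 \<Longrightarrow> p t (u t) \<le> f t"
  shows "((\<lambda>t. p t (u t)) \<longlongrightarrow> 0) at_top"
proof (rule tendsto_sandwich[OF _ _ tendsto_const assms(1)])
  show "\<forall>\<^sub>F t in at_top. 0 \<le> p t (u t)"
    using eventually_ge_at_top[of 0] by eventually_elim (rule orbit_norm_nonneg)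
  show "\<forall>\<^sub>F t in at_top. p t (u t) \<le> f t"
    using eventually_ge_at_top[of 0] by eventually_elim (rule assms(2))
qed

lemma subspace_adm_space: "subspace (adm_space U \<alpha>)"
proof (rule subspaceI)
  show "0 \<in> adm_space U \<alpha>"
    by (intro adm_spaceI tendsto_zero_orbit_normI[where f = "\<lambda>_. 0"])
      (auto simp: zero_fun_def orbit_norm_zero)
next
  fix u v assume u: "u \<in> adm_space U \<alpha>" and v: "v \<in> adm_space U \<alpha>"
  have "((\<lambda>t. p t (u t) + p t (v t)) \<longlongrightarrow> 0) at_top"
    using tendsto_add[OF adm_spaceD(3)[OF u] adm_spaceD(3)[OF v]] by simp
  then have "((\<lambda>t. p t ((u + v) t)) \<longlongrightarrow> 0) at_top"
    by (rule tendsto_zero_orbit_normI) (simp add: plus_fun_def orbit_norm_triangle)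
  then show "u + v \<in> adm_space U \<alpha>"
    using adm_spaceD[OF u] adm_spaceD[OF v]
    by (intro adm_spaceI) (auto simp: plus_fun_def intro!: continuous_intros)
next
  fix c :: real and u assume u: "u \<in> adm_space U \<alpha>"
  have "((\<lambda>t. \<bar>c\<bar> * p t (u t)) \<longlongrightarrow> 0) at_top"
    using tendsto_mult_left[OF adm_spaceD(3)[OF u], of "\<bar>c\<bar>"] by simp
  then have "((\<lambda>t. p t ((c *\<^sub>R u) t)) \<longlongrightarrow> 0) at_top"
    by (rule tendsto_zero_orbit_normI) (simp add: scaleR_fun_def orbit_norm_scaleR_le)
  then show "c *\<^sub>R u \<in> adm_space U \<alpha>"
    using adm_spaceD[OF u]
    by (intro adm_spaceI) (auto simp: scaleR_fun_def intro!: continuous_intros)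
qed

lemma adm_norm_scaleR_le:
  assumes "u \<in> adm_space U \<alpha>"
  shows "adm_norm U \<alpha> (c *\<^sub>R u) \<le> \<bar>c\<bar> * adm_norm U \<alpha> u"
proof (rule adm_norm_leI)
  fix t :: real assume t: "t \<ge> 0"
  have "p t ((c *\<^sub>R u) t) \<le> \<bar>c\<bar> * p t (u t)"
    using t by (simp add: scaleR_fun_def orbit_norm_scaleR_le)
  also have "\<dots> \<le> \<bar>c\<bar> * adm_norm U \<alpha> u"
    using t by (intro mult_left_mono le_adm_norm assms) auto
  finally show "p t ((c *\<^sub>R u) t) \<le> \<bar>c\<bar> * adm_norm U \<alpha> u" .
qed

lemma norm_on_adm_space: "norm_on (adm_space U \<alpha>) (adm_norm U \<alpha>)"
  unfolding norm_on_def
proof (intro conjI ballI allI)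
  fix u assume u: "u \<in> adm_space U \<alpha>"
  show "0 \<le> adm_norm U \<alpha> u"
    using u by (rule adm_norm_nonneg)
  show "adm_norm U \<alpha> u = 0 \<longleftrightarrow> u = 0"
  proof
    assume 0: "adm_norm U \<alpha> u = 0"
    have "u t = 0" for t
    proof (cases "t \<ge> 0")
      case True
      then show ?thesis
        using order_trans[OF norm_le_orbit_norm[of t "u t"] le_adm_norm[OF u, of t]] 0 by simp
    next
      case False
      then show ?thesis
        using adm_spaceD(2)[OF u] by simp
    qed
    then show "u = 0"
      by (simp add: fun_eq_iff zero_fun_def)
  next
    assume "u = 0"
    then have "adm_norm U \<alpha> u \<le> 0"
      by (intro adm_norm_leI) (simp add: zero_fun_def orbit_norm_zero)
    then show "adm_norm U \<alpha> u = 0"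
      using adm_norm_nonneg[OF u] by simp
  qed
next
  fix u v assume uv: "u \<in> adm_space U \<alpha>" "v \<in> adm_space U \<alpha>"
  show "adm_norm U \<alpha> (u + v) \<le> adm_norm U \<alpha> u + adm_norm U \<alpha> v"
  proof (rule adm_norm_leI)
    fix t :: real assume t: "t \<ge> 0"
    have "p t ((u + v) t) \<le> p t (u t) + p t (v t)"
      using t by (simp add: plus_fun_def orbit_norm_triangle)
    also have "\<dots> \<le> adm_norm U \<alpha> u + adm_norm U \<alpha> v"
      using t by (intro add_mono le_adm_norm uv)
    finally show "p t ((u + v) t) \<le> adm_norm U \<alpha> u + adm_norm U \<alpha> v" .
  qed
next
  fix c :: real and u assume u: "u \<in> adm_space U \<alpha>"
  show "adm_norm U \<alpha> (c *\<^sub>R u) = \<bar>c\<bar> * adm_norm U \<alpha> u"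
  proof (cases "c = 0")
    case True
    have "adm_norm U \<alpha> (c *\<^sub>R u) \<le> 0"
      using adm_norm_scaleR_le[OF u, of c] True by simp
    then show ?thesis
      using adm_norm_nonneg[OF subspace_scale[OF subspace_adm_space u], of c] True by simp
  next
    case False
    \<comment> \<open>Scaling back by the inverse gives the other inequality.\<close>
    have "adm_norm U \<alpha> ((1 / c) *\<^sub>R (c *\<^sub>R u)) \<le> \<bar>1 / c\<bar> * adm_norm U \<alpha> (c *\<^sub>R u)"
      by (intro adm_norm_scaleR_le subspace_scale[OF subspace_adm_space u])
    then have "\<bar>c\<bar> * adm_norm U \<alpha> u \<le> adm_norm U \<alpha> (c *\<^sub>R u)"
      using False by (simp add: field_simps abs_if split: if_splits)
    then show ?thesis
      using adm_norm_scaleR_le[OF u, of c] by simp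
  qed
qed

text \<open>Since \<open>\<parallel>x\<parallel> \<le> p\<^sub>t x\<close>, a Cauchy sequence has a uniform limit on the half-line. For fixed \<open>t\<close> and \<open>\<tau>\<close>
  the weighted orbit at \<open>\<tau>\<close> depends continuously on \<open>x\<close>, so the Cauchy estimate passes to the limit
  before the suprema are taken; this yields convergence in norm and, from the decay of a single
  close member of the sequence, the decay of the limit.\<close>

lemma adm_space_complete:
  assumes X: "\<And>n. X n \<in> adm_space U \<alpha>"
    and cauchy: "\<And>e. e > 0 \<Longrightarrow> \<exists>n0. \<forall>m\<ge>n0. \<forall>n\<ge>n0. adm_norm U \<alpha> (X m - X n) < e"
  shows "\<exists>u\<in>adm_space U \<alpha>. (\<lambda>n. adm_norm U \<alpha> (X n - u)) \<longlonglongrightarrow> 0"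
proof -
  have close: "\<exists>n0. \<forall>m\<ge>n0. \<forall>n\<ge>n0. \<forall>t\<ge>0. p t (X m t - X n t) < e" if "e > 0" for e
  proof -
    obtain n0 where n0: "\<And>m n. m \<ge> n0 \<Longrightarrow> n \<ge> n0 \<Longrightarrow> adm_norm U \<alpha> (X m - X n) < e"
      using cauchy[OF \<open>e > 0\<close>] by blast
    have "p t (X m t - X n t) < e" if "m \<ge> n0" "n \<ge> n0" "t \<ge> 0" for m n t
      using le_adm_norm[OF subspace_diff[OF subspace_adm_space X X] that(3), of m n]
        n0[OF that(1,2)] by simp
    then show ?thesis
      by blast
  qed
  have "uniformly_Cauchy_on {0..} X"
    unfolding uniformly_Cauchy_on_def
  proof (intro allI impI)
    fix e :: real assume "e > 0"
    then obtain n0 where n0: "\<And>m n t. m \<ge> n0 \<Longrightarrow> n \<ge> n0 \<Longrightarrow> t \<ge> 0 \<Longrightarrow> p t (X m t - X n t) < e"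
      using close by blast
    then have "\<forall>t\<in>{0..}. \<forall>m\<ge>n0. \<forall>n\<ge>n0. dist (X m t) (X n t) < e"
      unfolding dist_norm by (intro ballI allI impI le_less_trans[OF norm_le_orbit_norm n0]) auto
    then show "\<exists>n0. \<forall>t\<in>{0..}. \<forall>m\<ge>n0. \<forall>n\<ge>n0. dist (X m t) (X n t) < e" ..
  qed
  then obtain l where l: "uniform_limit {0..} X l sequentially"
    using Cauchy_uniformly_convergent uniformly_convergent_on_def by blast
  define u where "u t = (if t \<ge> 0 then l t else 0)" for t
  have lim: "(\<lambda>n. X n t) \<longlonglongrightarrow> u t" if "t \<ge> 0" for t
    using tendsto_uniform_limitI[OF l, of t] that by (simp add: u_def)
  have "continuous_on {0..} l"
    by (rule uniform_limit_theorem[OF _ l]) (auto simp: adm_spaceD(1)[OF X])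
  then have "continuous_on {0..} u"
    by (rule continuous_on_eq) (simp add: u_def)
  moreover have "u s = 0" if "s \<le> 0" for s
  proof (cases "s = 0")
    case True
    then show ?thesis
      using lim[of 0] adm_spaceD(2)[OF X, of 0] by (simp add: LIMSEQ_const_iff)
  qed (use that in \<open>simp add: u_def\<close>)
  moreover
  have approx: "\<exists>n0. \<forall>n\<ge>n0. \<forall>t\<ge>0. p t (X n t - u t) \<le> e" if "e > 0" for e
  proof -
    obtain n0 where n0: "\<And>m n t. m \<ge> n0 \<Longrightarrow> n \<ge> n0 \<Longrightarrow> t \<ge> 0 \<Longrightarrow> p t (X m t - X n t) < e"
      using close[OF \<open>e > 0\<close>] by blast
    have "p t (X n t - u t) \<le> e" if n: "n \<ge> n0" and t: "t \<ge> 0" for n t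
    proof (rule orbit_norm_leI)
      fix \<tau> assume \<tau>: "\<tau> \<ge> t"
      have "(\<lambda>m. exp (- \<alpha> * (\<tau> - t)) * norm (blinfun_apply (U \<tau> t) (X n t - X m t)))
          \<longlonglongrightarrow> exp (- \<alpha> * (\<tau> - t)) * norm (blinfun_apply (U \<tau> t) (X n t - u t))"
        by (intro tendsto_intros lim[OF t])
      then show "exp (- \<alpha> * (\<tau> - t)) * norm (blinfun_apply (U \<tau> t) (X n t - u t)) \<le> e"
      proof (rule LIMSEQ_le_const2, intro exI allI impI)
        fix m assume "m \<ge> n0"
        then show "exp (- \<alpha> * (\<tau> - t)) * norm (blinfun_apply (U \<tau> t) (X n t - X m t)) \<le> e"
          using orbit_le_orbit_norm[OF \<tau> t, of "X n t - X m t"] n0[OF n _ t, of m] by linarith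
      qed
    qed
    then show ?thesis
      by blast
  qed
  moreover have "((\<lambda>t. p t (u t)) \<longlongrightarrow> 0) at_top"
  proof (rule tendstoI)
    fix e :: real assume "e > 0"
    then obtain n where n: "\<And>t. t \<ge> 0 \<Longrightarrow> p t (X n t - u t) \<le> e / 2"
      using approx[of "e / 2"] by auto
    obtain L where L: "L \<ge> 0" "\<And>t. t \<ge> L \<Longrightarrow> p t (X n t) < e / 2"
      using eventually_small[OF X, of "e / 2" n] \<open>e > 0\<close> by auto
    have "dist (p t (u t)) 0 < e" if "t \<ge> L" for t
    proof -
      have t: "t \<ge> 0"
        using that L(1) by simp
      have "p t (u t) \<le> p t (X n t) + p t (X n t - u t)"
        using orbit_norm_diff_le[OF t, of "X n t" "X n t - u t"] by simp
      then show ?thesis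
        using L(2)[OF that] n[OF t] orbit_norm_nonneg[OF t, of "u t"] by simp
    qed
    then show "\<forall>\<^sub>F t in at_top. dist (p t (u t)) 0 < e"
      unfolding eventually_at_top_linorder by blast
  qed
  ultimately have u: "u \<in> adm_space U \<alpha>"
    by (intro adm_spaceI)
  have "(\<lambda>n. adm_norm U \<alpha> (X n - u)) \<longlonglongrightarrow> 0"
  proof (rule LIMSEQ_I)
    fix e :: real assume "e > 0"
    then obtain n0 where n0: "\<And>n t. n \<ge> n0 \<Longrightarrow> t \<ge> 0 \<Longrightarrow> p t (X n t - u t) \<le> e / 2"
      using approx[of "e / 2"] by auto
    have "norm (adm_norm U \<alpha> (X n - u) - 0) < e" if "n \<ge> n0" for n
    proof -
      have "adm_norm U \<alpha> (X n - u) \<le> e / 2"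
        using n0[OF that] by (intro adm_norm_leI) (simp only: fun_diff_def)
      then show ?thesis
        using adm_norm_nonneg[OF subspace_diff[OF subspace_adm_space X u], of n] \<open>e > 0\<close> by simp
    qed
    then show "\<exists>n0. \<forall>n\<ge>n0. norm (adm_norm U \<alpha> (X n - u) - 0) < e"
      by blast
  qed
  with u show ?thesis by blast
qed

lemma banach_space_on_adm_space: "banach_space_on (adm_space U \<alpha>) (adm_norm U \<alpha>)"
  unfolding banach_space_on_def
  using subspace_adm_space norm_on_adm_space adm_space_complete by blast

section \<open>The evolution semigroup\<close>

text \<open>Strong continuity of \<open>U\<close> together with its local uniform boundedness gives joint continuity in
  the two times and the vector.\<close>

lemma continuous_on_U:
  fixes a b :: "'b::topological_space \<Rightarrow> real"
  assumes a: "continuous_on S a" and b: "continuous_on S b" and f: "continuous_on S f"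
    and ab: "\<And>z. z \<in> S \<Longrightarrow> b z \<le> a z" "\<And>z. z \<in> S \<Longrightarrow> 0 \<le> b z"
  shows "continuous_on S (\<lambda>z. blinfun_apply (U (a z) (b z)) (f z))"
  unfolding continuous_on_def
proof
  fix z0 assume z0: "z0 \<in> S"
  have "continuous_on {(t, s). t \<ge> s \<and> s \<ge> 0} (\<lambda>(t, s). blinfun_apply (U t s) (f z0))"
    using evolution by (simp add: evolution_family_def)
  then have "continuous_on S (\<lambda>z. case (a z, b z) of (t, s) \<Rightarrow> blinfun_apply (U t s) (f z0))"
    by (rule continuous_on_compose2) (use ab in \<open>auto intro!: continuous_intros a b\<close>)
  then have 1: "((\<lambda>z. blinfun_apply (U (a z) (b z)) (f z0))
      \<longlongrightarrow> blinfun_apply (U (a z0) (b z0)) (f z0)) (at z0 within S)"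
    using z0 by (simp add: continuous_on_def)
  have "continuous_on S (\<lambda>z. M (b z) * exp (\<alpha> * (a z - b z)) * norm (f z - f z0))"
    using ab by (intro continuous_intros continuous_on_compose2[OF M_continuous b] a b f) auto
  then have "((\<lambda>z. M (b z) * exp (\<alpha> * (a z - b z)) * norm (f z - f z0)) \<longlongrightarrow> 0) (at z0 within S)"
    using z0 by (force simp: continuous_on_def)
  moreover have "\<forall>\<^sub>F z in at z0 within S. norm (blinfun_apply (U (a z) (b z)) (f z - f z0))
      \<le> M (b z) * exp (\<alpha> * (a z - b z)) * norm (f z - f z0)"
    unfolding eventually_at_filter
    by (intro always_eventually allI impI order_trans[OF norm_blinfun] mult_right_mono norm_U_le ab) auto
  ultimately have 2: "((\<lambda>z. blinfun_apply (U (a z) (b z)) (f z - f z0)) \<longlongrightarrow> 0) (at z0 within S)"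
    by (rule Lim_null_comparison[rotated])
  show "((\<lambda>z. blinfun_apply (U (a z) (b z)) (f z))
      \<longlongrightarrow> blinfun_apply (U (a z0) (b z0)) (f z0)) (at z0 within S)"
    using tendsto_add[OF 1 2] by (simp add: blinfun.diff_right)
qed

text \<open>Because \<open>u 0 = 0\<close>, the zero branch is the value of the other branch at the time
  \<open>max s t\<close>, so a single formula covers both.\<close>

lemma evolution_semigroup_eq_max:
  assumes "u \<in> adm_space U \<alpha>"
  shows "evolution_semigroup U t u s
    = blinfun_apply (U (max s t) (max s t - t)) (u (max s t - t))"
  using adm_spaceD(2)[OF assms, of 0] by (simp add: evolution_semigroup_def max_def blinfun.zero_right)

lemma continuous_on_evolution_semigroup:
  assumes u: "u \<in> adm_space U \<alpha>"
  shows "continuous_on ({0..} \<times> {0..}) (\<lambda>(t, s). evolution_semigroup U t u s)"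
proof -
  have "continuous_on ({0..} \<times> {0..}) (\<lambda>z. blinfun_apply
      (U (max (snd z) (fst z)) (max (snd z) (fst z) - fst z)) (u (max (snd z) (fst z) - fst z)))"
    by (intro continuous_on_U continuous_on_compose2[OF adm_spaceD(1)[OF u]] continuous_intros) auto
  then show ?thesis
    by (simp add: evolution_semigroup_eq_max[OF u] case_prod_unfold)
qed

lemma orbit_norm_evolution_semigroup_le:
  assumes "s > t" "t \<ge> 0"
  shows "p s (evolution_semigroup U t u s) \<le> exp (\<alpha> * t) * p (s - t) (u (s - t))"
  using orbit_norm_U_le[of "s - t" s "u (s - t)"] assms by (simp add: evolution_semigroup_def)

lemma evolution_semigroup_in_adm_space:
  assumes u: "u \<in> adm_space U \<alpha>" and t: "t \<ge> 0"
  shows "evolution_semigroup U t u \<in> adm_space U \<alpha>"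
proof (rule adm_spaceI)
  show "continuous_on {0..} (evolution_semigroup U t u)"
  proof -
    have "continuous_on {0..} (\<lambda>s. case (t, s) of (t, s) \<Rightarrow> evolution_semigroup U t u s)"
      by (rule continuous_on_compose2[OF continuous_on_evolution_semigroup[OF u]])
        (use t in \<open>auto intro!: continuous_intros\<close>)
    then show ?thesis
      by simp
  qed
  show "evolution_semigroup U t u s = 0" if "s \<le> 0" for s
    using that t by (simp add: evolution_semigroup_def)
  show "((\<lambda>s. p s (evolution_semigroup U t u s)) \<longlongrightarrow> 0) at_top"
  proof (rule tendsto_sandwich[OF _ _ tendsto_const])
    show "\<forall>\<^sub>F s in at_top. 0 \<le> p s (evolution_semigroup U t u s)"
      using eventually_ge_at_top[of 0] by eventually_elim (rule orbit_norm_nonneg)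
    show "\<forall>\<^sub>F s in at_top. p s (evolution_semigroup U t u s) \<le> exp (\<alpha> * t) * p (s - t) (u (s - t))"
      using eventually_gt_at_top[of t]
      by eventually_elim (rule orbit_norm_evolution_semigroup_le[OF _ t])
    have "filterlim (\<lambda>s. s - t) at_top at_top"
      using filterlim_tendsto_add_at_top[OF tendsto_const filterlim_ident, of "- t"] by simp
    then have "((\<lambda>s. p (s - t) (u (s - t))) \<longlongrightarrow> 0) at_top"
      by (rule filterlim_compose[OF adm_spaceD(3)[OF u]])
    then show "((\<lambda>s. exp (\<alpha> * t) * p (s - t) (u (s - t))) \<longlongrightarrow> 0) at_top"
      by (rule tendsto_mult_right_zero)
  qed
qed

lemma adm_norm_evolution_semigroup_le:
  assumes u: "u \<in> adm_space U \<alpha>" and t: "t \<ge> 0"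
  shows "adm_norm U \<alpha> (evolution_semigroup U t u) \<le> exp (\<alpha> * t) * adm_norm U \<alpha> u"
proof (rule adm_norm_leI)
  fix s :: real assume s: "s \<ge> 0"
  show "p s (evolution_semigroup U t u s) \<le> exp (\<alpha> * t) * adm_norm U \<alpha> u"
  proof (cases "s > t")
    case True
    have "p s (evolution_semigroup U t u s) \<le> exp (\<alpha> * t) * p (s - t) (u (s - t))"
      using True t by (rule orbit_norm_evolution_semigroup_le)
    also have "\<dots> \<le> exp (\<alpha> * t) * adm_norm U \<alpha> u"
      using True by (intro mult_left_mono le_adm_norm[OF u]) auto
    finally show ?thesis .
  next
    case False
    then show ?thesis
      using s adm_norm_nonneg[OF u] by (simp add: evolution_semigroup_def orbit_norm_zero)
  qed
qed

lemma evolution_semigroup_0: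
  assumes "u \<in> adm_space U \<alpha>"
  shows "evolution_semigroup U 0 u = u"
  using adm_spaceD(2)[OF assms] by (auto simp: fun_eq_iff evolution_semigroup_def U_refl)

lemma evolution_semigroup_add:
  assumes "t \<ge> 0" "s \<ge> 0"
  shows "evolution_semigroup U t (evolution_semigroup U s u) = evolution_semigroup U (t + s) u"
proof
  fix r
  show "evolution_semigroup U t (evolution_semigroup U s u) r = evolution_semigroup U (t + s) u r"
    using assms U_comp[of "r - t" r "r - t - s"]
    by (auto simp: evolution_semigroup_def blinfun.zero_right algebra_simps)
qed

lemma bounded_operator_on_evolution_semigroup:
  assumes "t \<ge> 0"
  shows "bounded_operator_on (adm_space U \<alpha>) (adm_norm U \<alpha>) (evolution_semigroup U t)"
  unfolding bounded_operator_on_def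
  using evolution_semigroup_in_adm_space[OF _ assms] adm_norm_evolution_semigroup_le[OF _ assms]
  by (auto simp: evolution_semigroup_def fun_eq_iff plus_fun_def scaleR_fun_def
      blinfun.add_right blinfun.scaleR_right)

text \<open>Beyond a time \<open>L + 1\<close> the functions \<open>T t u\<close> with \<open>t \<le> 1\<close> and \<open>u\<close> are small by decay. Before it,
  uniform continuity of \<open>(t, s) \<mapsto> (T t u) s\<close> on a compact rectangle applies.\<close>

lemma evolution_semigroup_strongly_continuous:
  assumes u: "u \<in> adm_space U \<alpha>"
  shows "((\<lambda>t. adm_norm U \<alpha> (evolution_semigroup U t u - u)) \<longlongrightarrow> 0) (at_right 0)"
proof (rule tendstoI)
  fix e :: real assume e: "e > 0"
  (* C bounds the growth factors exp (\<alpha> t) for t \<in> [0, 1], whatever the sign of \<alpha>. *)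
  define C where "C = exp \<bar>\<alpha>\<bar>"
  have C: "C \<ge> 1" "\<And>t. 0 \<le> t \<Longrightarrow> t \<le> 1 \<Longrightarrow> exp (\<alpha> * t) \<le> C"
  proof -
    fix t :: real assume "0 \<le> t" "t \<le> 1"
    then have "\<alpha> * t \<le> \<bar>\<alpha>\<bar> * 1"
      by (intro mult_mono) auto
    then show "exp (\<alpha> * t) \<le> C"
      by (simp add: C_def)
  qed (simp add: C_def)
  obtain L where L: "L \<ge> 0" "\<And>s. s \<ge> L \<Longrightarrow> p s (u s) < e / (4 * C)"
    using eventually_small[OF u, of "e / (4 * C)"] e C(1) by auto
  obtain K where K: "K > 0" "\<And>s. 0 \<le> s \<Longrightarrow> s \<le> L + 1 \<Longrightarrow> M s \<le> K"
    using M_bounded_on_interval[of "L + 1"] by blast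
  have "uniformly_continuous_on ({0..1} \<times> {0..L+1}) (\<lambda>(t, s). evolution_semigroup U t u s)"
    by (intro compact_uniformly_continuous compact_Times
        continuous_on_subset[OF continuous_on_evolution_semigroup[OF u]]) auto
  moreover have "e / (2 * K) > 0"
    using e K(1) by simp
  ultimately obtain d where d: "d > 0"
    "\<And>z z'. z \<in> {0..1} \<times> {0..L+1} \<Longrightarrow> z' \<in> {0..1} \<times> {0..L+1} \<Longrightarrow> dist z' z < d \<Longrightarrow>
      dist (case z' of (t, s) \<Rightarrow> evolution_semigroup U t u s)
        (case z of (t, s) \<Rightarrow> evolution_semigroup U t u s) < e / (2 * K)"
    unfolding uniformly_continuous_on_def by meson
  have "dist (adm_norm U \<alpha> (evolution_semigroup U t u - u)) 0 < e" if t: "0 < t" "t < min d 1" for t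
  proof -
    have "adm_norm U \<alpha> (evolution_semigroup U t u - u) \<le> e / 2"
    proof (rule adm_norm_leI)
      fix s :: real assume s: "s \<ge> 0"
      show "p s ((evolution_semigroup U t u - u) s) \<le> e / 2"
      proof (cases "s \<le> L + 1")
        case True
        have "dist (evolution_semigroup U t u s) (evolution_semigroup U 0 u s) < e / (2 * K)"
          using d(2)[of "(0, s)" "(t, s)"] t s True by (simp add: dist_Pair_Pair)
        then have small: "norm (evolution_semigroup U t u s - u s) \<le> e / (2 * K)"
          by (simp add: dist_norm evolution_semigroup_0[OF u])
        have "p s (evolution_semigroup U t u s - u s) \<le> M s * norm (evolution_semigroup U t u s - u s)"
          using s by (rule orbit_norm_le)
        also have "\<dots> \<le> K * (e / (2 * K))"
          using K s True small by (intro mult_mono) auto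
        also have "\<dots> = e / 2"
          using K(1) by simp
        finally show ?thesis
          by simp
      next
        case False
        then have "s - t \<ge> L" "s > t"
          using t L(1) by auto
        have "p s (evolution_semigroup U t u s) \<le> exp (\<alpha> * t) * p (s - t) (u (s - t))"
          using \<open>s > t\<close> t by (intro orbit_norm_evolution_semigroup_le) auto
        also have "\<dots> \<le> C * (e / (4 * C))"
          using C t L(2)[OF \<open>s - t \<ge> L\<close>] orbit_norm_nonneg[of "s - t"] \<open>s > t\<close>
          by (intro mult_mono) auto
        also have "\<dots> = e / 4"
          using C(1) by simp
        finally have 1: "p s (evolution_semigroup U t u s) \<le> e / 4" .
        have "p s (u s) \<le> e / (4 * C)"
          using L(2)[of s] False by simp
        also have "\<dots> \<le> e / 4"
          using C(1) e by (simp add: field_simps)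
        finally show ?thesis
          using 1 orbit_norm_diff_le[OF s, of "evolution_semigroup U t u s" "u s"] by simp
      qed
    qed
    moreover have "adm_norm U \<alpha> (evolution_semigroup U t u - u) \<ge> 0"
      using t by (intro adm_norm_nonneg subspace_diff[OF subspace_adm_space] u
          evolution_semigroup_in_adm_space) auto
    ultimately show ?thesis
      using e by simp
  qed
  then show "\<forall>\<^sub>F t in at_right 0. dist (adm_norm U \<alpha> (evolution_semigroup U t u - u)) 0 < e"
    unfolding eventually_at_right_field using d(1)
    by (intro exI[of _ "min d 1"]) auto
qed

lemma C0_semigroup_on_evolution_semigroup:
  "C0_semigroup_on (adm_space U \<alpha>) (adm_norm U \<alpha>) (evolution_semigroup U)"
  unfolding C0_semigroup_on_def
  using banach_space_on_adm_space bounded_operator_on_evolution_semigroup evolution_semigroup_0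
    evolution_semigroup_add evolution_semigroup_strongly_continuous by simp

end

theorem theorem2p5:
  fixes U :: "real \<Rightarrow> real \<Rightarrow> 'a::banach \<Rightarrow>\<^sub>L 'a"
  assumes "evolution_family U" and "nonuniform_exp_bounded U"
  shows "\<forall>\<alpha>\<in>admissible_exponents U.
      C0_semigroup_on (adm_space U \<alpha>) (adm_norm U \<alpha>) (evolution_semigroup U) \<and>
      (\<forall>u\<in>adm_space U \<alpha>. \<forall>t\<ge>0.
         adm_norm U \<alpha> (evolution_semigroup U t u) \<le> exp (\<alpha> * t) * adm_norm U \<alpha> u)"
proof
  fix \<alpha> assume "\<alpha> \<in> admissible_exponents U"
  then obtain M :: "real \<Rightarrow> real" where "continuous_on {0..} M"
    and "\<forall>t s. t \<ge> s \<and> s \<ge> 0 \<longrightarrow> norm (U t s) \<le> M s * exp (\<alpha> * (t - s))"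
    unfolding admissible_exponents_def by blast
  then interpret exp_bounded_family U \<alpha> M
    using assms(1) by unfold_locales auto
  show "C0_semigroup_on (adm_space U \<alpha>) (adm_norm U \<alpha>) (evolution_semigroup U) \<and>
      (\<forall>u\<in>adm_space U \<alpha>. \<forall>t\<ge>0.
         adm_norm U \<alpha> (evolution_semigroup U t u) \<le> exp (\<alpha> * t) * adm_norm U \<alpha> u)"
    using C0_semigroup_on_evolution_semigroup adm_norm_evolution_semigroup_le by blast
qed

end
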